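(* Let $D$ be a fixed positive integer. For an integer $c \ge 0$, consider the Diophantine equation $x^3 + D = 2^c y$ in integers $x, y$ with $y$ odd. (a) If $D$ is not of the form $2^{3k}(2j+1)$ with $k, j \in \mathbb{Z}_{\ge 0}$, then there are only finitely many $c$ for which the equation has nontrivial solutions. Specifically: (i) if $D = 2(2j+1)$ with $j \in \mathbb{Z}_{\ge 0}$, then $c = 0$ or $c = 1$, and $x$ is odd or even, respectively; (ii) if $D = 2^2(2j+1)$ with $j \in \mathbb{Z}_{\ge 0}$, then $c = 0$ or $c = 2$, and $x$ is odd or even, respectively; (iii) if $D = 2^{3k+i}$ with $i \in \{1,2\}$ and $k$ a positive integer, then solutions are of the form $x \equiv 2^{\ell} \pmod{2^{\ell+1}}$ with corresponding $c = 3\ell$ for integers $0 \le \ell < k+i$; and if $\ell = k+i$, then $x$ is of the form $x \equiv 0 \pmod{2^{k+i}}$ and $c = 3k+i$. (b) If $D = 2^{3k}(2j+1)$ for some $k, j \in \mathbb{Z}_{\ge 0}$, then $x^3 + D = 2^c y$ (with $y$ odd) has nontrivial solutions for all integers $c \ge 0$ except for finitely many values of $c$.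
   Context: Since $y$ is required to be odd, $c$ is the $2$-adic valuation of $x^3+D$, i.e. the exponent of the largest power of $2$ dividing $x^3+D$. A nontrivial solution is understood as a pair of integers $x, y$ with $y$ odd satisfying the equation. The integer $\ell \ge 0$ stands for a level in the binary tree that records this valuation according to the residue class of $x$ modulo $2^{\ell}$.
   Formalization: In (a)(iii) the threshold k+i is replaced by k+1 (c = 3ℓ for 0 ≤ ℓ < k+1; x ≡ 0 mod 2^{k+1} gives c = 3k+i), since for i = 2 the printed claim fails: D = 32, x = 4 gives 96 = 2^5·3, so c = 5, not 6. *)

theory Defs
  imports "HOL-Number_Theory.Cong"
begin

definition nontrivial_solution :: "int \<Rightarrow> nat \<Rightarrow> int \<Rightarrow> int \<Rightarrow> bool" where
  "nontrivial_solution D c x y \<longleftrightarrow> odd y \<and> x ^ 3 + D = 2 ^ c * y"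

end

theory Submission
  imports Defs
begin

text \<open>
  Write \<open>D = 2 ^ m * d\<close> with \<open>d\<close> odd. The question is how the 2-adic valuation of
  \<open>x ^ 3 + D\<close> depends on \<open>x\<close>. The valuation of a nonzero cube is a multiple of 3, and a sum of
  two terms with different valuations has the smaller of the two as its valuation. Everything
  therefore depends on whether 3 divides \<open>m\<close>.

  If \<open>m = 3 * k + i\<close> with \<open>i\<close> equal to 1 or 2, the two terms never have the same valuation.
  Hence \<open>c\<close> is \<open>3 * l\<close> when \<open>x\<close> has valuation \<open>l \<le> k\<close>, and it is \<open>m\<close> when \<open>2 ^ (k + 1)\<close> divides
  \<open>x\<close>. This is \<open>solution_iff_not_cube_exponent\<close>, which yields every claim about such \<open>D\<close>: powers
  of two are the case \<open>d = 1\<close>, the constants \<open>2 * d\<close> and \<open>4 * d\<close> are the case \<open>k = 0\<close>, and only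
  finitely many \<open>c\<close> occur because \<open>c \<le> m\<close>.

  If \<open>m = 3 * k\<close>, the two terms can cancel: with \<open>x = 2 ^ k * z\<close> one has
  \<open>x ^ 3 + D = 2 ^ (3 * k) * (z ^ 3 + d)\<close>. Every odd number is a cube modulo every power of 2
  (\<open>odd_is_cube_mod_power_of_two\<close>), so \<open>z ^ 3 + d\<close> can be given any valuation \<open>e \<ge> 1\<close>:
  take \<open>z ^ 3\<close> congruent to \<open>2 ^ e - d\<close> modulo \<open>2 ^ (e + 1)\<close>. All \<open>c > 3 * k\<close> therefore occur.
\<close>

section \<open>Valuation of a cube plus a constant\<close>

lemma power_of_two_times_odd_unique:
  fixes u v :: int
  assumes "2 ^ a * u = 2 ^ b * v" "odd u" "odd v"
  shows "a = b"
proof -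
  have le: "n \<le> m" if "2 ^ m * s = 2 ^ n * t" "odd s" for m n and s t :: int
  proof (rule ccontr)
    assume "\<not> n \<le> m"
    then have "(2::int) ^ n = 2 ^ m * (2 * 2 ^ (n - m - 1))"
      by (simp flip: power_Suc power_add)
    then have "s = 2 * (2 ^ (n - m - 1) * t)"
      using that(1) by (simp add: mult.assoc)
    with \<open>odd s\<close> show False by simp
  qed
  show ?thesis
    using le[OF assms(1,2)] le[OF assms(1)[symmetric] assms(3)] by simp
qed

lemma solution_exponent_unique:
  assumes "nontrivial_solution D a x y" "nontrivial_solution D b x z"
  shows "a = b"
  using assms power_of_two_times_odd_unique unfolding nontrivial_solution_def by metis

text \<open>
  After division by the smaller of the two powers of 2, one of the terms \<open>x ^ 3\<close> and \<open>D\<close> is odd and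
  the other even, so the cofactor \<open>y\<close> is odd. Only divisibility of \<open>x\<close> is assumed where \<open>D\<close>
  decides, so that \<open>x = 0\<close> is covered there.
\<close>

lemma solution_iff_cube_dominates:
  fixes u d :: int
  assumes "odd u" "3 * l < m"
  shows "(\<exists>y. nontrivial_solution (2 ^ m * d) c (2 ^ l * u) y) \<longleftrightarrow> c = 3 * l"
proof -
  have "(2::int) ^ m = 2 ^ (3 * l) * (2 * 2 ^ (m - 3 * l - 1))"
    using assms(2) by (simp flip: power_Suc power_add)
  then have "nontrivial_solution (2 ^ m * d) (3 * l) (2 ^ l * u)
      (u ^ 3 + 2 * 2 ^ (m - 3 * l - 1) * d)"
    using assms(1) unfolding nontrivial_solution_def
    by (simp add: power_mult_distrib distrib_left mult.assoc mult.commute[of 3 l] flip: power_mult)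
  then show ?thesis by (metis solution_exponent_unique)
qed

lemma solution_iff_constant_dominates:
  fixes d x :: int
  assumes "odd d" "2 ^ l dvd x" "m < 3 * l"
  shows "(\<exists>y. nontrivial_solution (2 ^ m * d) c x y) \<longleftrightarrow> c = m"
proof -
  obtain w where w: "x = 2 ^ l * w" using assms(2) by (elim dvdE)
  have "(2::int) ^ (3 * l) = 2 ^ m * (2 * 2 ^ (3 * l - m - 1))"
    using assms(3) by (simp flip: power_Suc power_add)
  then have "x ^ 3 = 2 ^ m * (2 * 2 ^ (3 * l - m - 1)) * w ^ 3"
    unfolding w by (simp add: power_mult_distrib mult.commute[of 3 l] flip: power_mult)
  then have "nontrivial_solution (2 ^ m * d) m x (2 * 2 ^ (3 * l - m - 1) * w ^ 3 + d)"
    using assms(1) unfolding nontrivial_solution_def by (simp add: distrib_left mult.assoc)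
  then show ?thesis by (metis solution_exponent_unique)
qed

section \<open>Constants whose valuation is not a multiple of three\<close>

lemma power_of_two_times_odd_decomposition:
  fixes x :: int
  assumes "x \<noteq> 0"
  obtains l u where "x = 2 ^ l * u" "odd u"
proof -
  have "\<not> is_unit (2::int)" by simp
  with assms obtain u where "x = 2 ^ multiplicity 2 x * u" "odd u"
    by (rule multiplicity_decompose')
  then show thesis by (rule that)
qed

lemma cong_power_of_two_iff:
  fixes x :: int
  shows "[x = 2 ^ l] (mod 2 ^ (l + 1)) \<longleftrightarrow> (\<exists>u. odd u \<and> x = 2 ^ l * u)"
proof
  assume "[x = 2 ^ l] (mod 2 ^ (l + 1))"
  then obtain t where "x - 2 ^ l = 2 ^ (l + 1) * t" by (auto simp: cong_iff_dvd_diff elim: dvdE)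
  then have "x = 2 ^ l * (1 + 2 * t)" by (simp add: algebra_simps)
  then show "\<exists>u. odd u \<and> x = 2 ^ l * u" by (intro exI[of _ "1 + 2 * t"]) simp
next
  assume "\<exists>u. odd u \<and> x = 2 ^ l * u"
  then obtain t where "x = 2 ^ l * (2 * t + 1)" by (auto elim: oddE)
  then have "x - 2 ^ l = 2 ^ (l + 1) * t" by (simp add: algebra_simps)
  then show "[x = 2 ^ l] (mod 2 ^ (l + 1))" by (simp add: cong_iff_dvd_diff)
qed

text \<open>
  The threshold is \<open>k + 1\<close> because \<open>3 * k < 3 * k + i < 3 * (k + 1)\<close>: an \<open>x\<close> of valuation at most
  \<open>k\<close> has a cube of smaller valuation than \<open>D\<close>, and every other \<open>x\<close>, including 0, is a multiple of
  \<open>2 ^ (k + 1)\<close> and leaves the decision to \<open>D\<close>.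
\<close>

lemma solution_iff_not_cube_exponent:
  fixes d x :: int
  assumes "odd d" "i \<in> {1, 2}"
  shows "(\<exists>y. nontrivial_solution (2 ^ (3 * k + i) * d) c x y) \<longleftrightarrow>
      (\<exists>l. l < k + 1 \<and> [x = 2 ^ l] (mod 2 ^ (l + 1)) \<and> c = 3 * l) \<or>
      ([x = 0] (mod 2 ^ (k + 1)) \<and> c = 3 * k + i)"
    (is "?sol \<longleftrightarrow> ?low \<or> ?high")
proof
  assume ?sol
  show "?low \<or> ?high"
  proof (cases "2 ^ (k + 1) dvd x")
    case True
    then have "c = 3 * k + i"
      using solution_iff_constant_dominates[of d "k + 1" x "3 * k + i" c] \<open>?sol\<close> assms by auto
    then show ?thesis using True by (simp add: cong_0_iff)
  next
    case False
    then have "x \<noteq> 0" by auto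
    then obtain l u where x: "x = 2 ^ l * u" and u: "odd u"
      by (rule power_of_two_times_odd_decomposition)
    have l: "l < k + 1"
      using False unfolding x by (meson dvd_mult2 le_imp_power_dvd not_le)
    then have "c = 3 * l"
      using solution_iff_cube_dominates[of u l "3 * k + i" d c] \<open>?sol\<close> u assms(2) x by auto
    then show ?thesis using l x u cong_power_of_two_iff by blast
  qed
next
  assume "?low \<or> ?high"
  then show ?sol
  proof
    assume ?low
    then obtain l u where "l < k + 1" "c = 3 * l" "odd u" "x = 2 ^ l * u"
      using cong_power_of_two_iff by blast
    then show ?sol
      using solution_iff_cube_dominates[of u l "3 * k + i" d c] assms(2) by auto
  next
    assume ?high
    then show ?sol
      using solution_iff_constant_dominates[of d "k + 1" x "3 * k + i" c] assms
      by (auto simp: cong_0_iff)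
  qed
qed

lemma solution_iff_parity:
  fixes d x :: int
  assumes "odd d" "i \<in> {1, 2}"
  shows "(\<exists>y. nontrivial_solution (2 ^ i * d) c x y) \<longleftrightarrow>
      (c = 0 \<and> odd x) \<or> (c = i \<and> even x)"
  using solution_iff_not_cube_exponent[OF assms, of 0 c x]
    cong_power_of_two_iff[of x 0]
  by (auto simp: cong_0_iff)

lemma finite_exponents:
  fixes d :: int
  assumes "odd d" "\<not> 3 dvd m"
  shows "finite {c. \<exists>x y. nontrivial_solution (2 ^ m * d) c x y}"
proof -
  define k i where "k = m div 3" and "i = m mod 3"
  have m: "m = 3 * k + i" and i: "i \<in> {1, 2}"
    using assms(2) by (auto simp: k_def i_def dvd_eq_mod_eq_0)
  have "c \<le> m" if "\<exists>y. nontrivial_solution (2 ^ m * d) c x y" for c x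
    using that unfolding m solution_iff_not_cube_exponent[OF assms(1) i] by auto
  then have "{c. \<exists>x y. nontrivial_solution (2 ^ m * d) c x y} \<subseteq> {..m}" by blast
  then show ?thesis by (rule finite_subset) simp
qed

section \<open>Constants whose valuation is a multiple of three\<close>

text \<open>
  Hensel lifting. The derivative \<open>3 * z ^ 2\<close> of the cube is odd at an odd \<open>z\<close>, so adding \<open>2 ^ n\<close>
  to \<open>z\<close> changes \<open>z ^ 3\<close> by \<open>2 ^ n\<close> modulo \<open>2 ^ (n + 1)\<close>. If \<open>z ^ 3\<close> agrees with \<open>a\<close> modulo
  \<open>2 ^ n\<close> only, this corrects the next binary digit. The induction starts at modulus 2 because
  the quadratic terms vanish modulo \<open>2 ^ (n + 1)\<close> only for \<open>n \<ge> 1\<close>.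
\<close>

lemma odd_is_cube_mod_power_of_two:
  fixes a :: int
  assumes "odd a"
  shows "\<exists>z. odd z \<and> 2 ^ Suc n dvd z ^ 3 - a"
proof (induction n)
  case 0
  show ?case using assms by (intro exI[of _ 1]) simp
next
  case (Suc n)
  define q :: int where "q = 2 ^ Suc n"
  have q: "even q" "2 ^ Suc (Suc n) = 2 * q" by (simp_all add: q_def)
  obtain z t where z: "odd z" and t: "z ^ 3 - a = q * t"
    using Suc unfolding q_def by (auto elim: dvdE)
  show ?case
  proof (cases "even t")
    case True
    then have "2 * q dvd z ^ 3 - a" unfolding t by (auto elim!: evenE)
    then show ?thesis using z q by auto
  next
    case False
    have "(z + q) ^ 3 - a = q * (t + 3 * z ^ 2 + 3 * z * q + q ^ 2)"
      using t by (simp add: power2_eq_square power3_eq_cube algebra_simps)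
    moreover have "even (t + 3 * z ^ 2 + 3 * z * q + q ^ 2)"
      using False z q by simp
    ultimately have "2 * q dvd (z + q) ^ 3 - a"
      by (metis mult.commute mult_dvd_mono dvd_refl)
    then show ?thesis using z q by (intro exI[of _ "z + q"]) auto
  qed
qed

lemma solution_exists_above_cube_exponent:
  fixes d :: int
  assumes "odd d" "3 * k < c"
  shows "\<exists>x y. nontrivial_solution (2 ^ (3 * k) * d) c x y"
proof -
  define e where "e = c - 3 * k"
  have e: "e > 0" "c = 3 * k + e" using assms(2) by (simp_all add: e_def)
  then have "odd (2 ^ e - d)" using assms(1) by simp
  then obtain z t where "z ^ 3 - (2 ^ e - d) = 2 ^ Suc e * t"
    using odd_is_cube_mod_power_of_two[of "2 ^ e - d" e] by (meson dvdE)
  then have z: "z ^ 3 + d = 2 ^ e * (2 * t + 1)" by (simp add: algebra_simps)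
  have "(2 ^ k * z) ^ 3 + 2 ^ (3 * k) * d = 2 ^ (3 * k) * (z ^ 3 + d)"
    by (simp add: power_mult_distrib distrib_left mult.commute[of 3 k] flip: power_mult)
  also have "\<dots> = 2 ^ c * (2 * t + 1)"
    unfolding z e(2) by (simp add: power_add mult.assoc)
  finally show ?thesis
    unfolding nontrivial_solution_def
    by (intro exI[of _ "2 ^ k * z"] exI[of _ "2 * t + 1"]) simp
qed

section \<open>Classification of the exponents\<close>

theorem theorem1p2:
  fixes D :: int
  assumes "D > 0"
  shows
    "((\<nexists>k j :: nat. D = 2 ^ (3 * k) * (2 * int j + 1)) \<longrightarrow>
        finite {c :: nat. \<exists>x y. nontrivial_solution D c x y})
     \<and> (\<forall>j :: nat. D = 2 * (2 * int j + 1) \<longrightarrow>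
        (\<forall>(c :: nat) x. (\<exists>y. nontrivial_solution D c x y) \<longleftrightarrow>
           (c = 0 \<and> odd x) \<or> (c = 1 \<and> even x)))
     \<and> (\<forall>j :: nat. D = 2 ^ 2 * (2 * int j + 1) \<longrightarrow>
        (\<forall>(c :: nat) x. (\<exists>y. nontrivial_solution D c x y) \<longleftrightarrow>
           (c = 0 \<and> odd x) \<or> (c = 2 \<and> even x)))
     \<and> (\<forall>k i :: nat. k > 0 \<and> i \<in> {1, 2} \<and> D = 2 ^ (3 * k + i) \<longrightarrow>
        (\<forall>(c :: nat) x. (\<exists>y. nontrivial_solution D c x y) \<longleftrightarrow>
           (\<exists>l :: nat. l < k + 1 \<and> [x = 2 ^ l] (mod 2 ^ (l + 1)) \<and> c = 3 * l) \<or>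
           ([x = 0] (mod 2 ^ (k + 1)) \<and> c = 3 * k + i)))
     \<and> ((\<exists>k j :: nat. D = 2 ^ (3 * k) * (2 * int j + 1)) \<longrightarrow>
        finite {c :: nat. \<not> (\<exists>x y. nontrivial_solution D c x y)})"
proof (intro conjI impI allI)
  assume not_cube: "\<nexists>k j :: nat. D = 2 ^ (3 * k) * (2 * int j + 1)"
  obtain m d where D: "D = 2 ^ m * d" and d: "odd d"
    using power_of_two_times_odd_decomposition[of D] assms by auto
  have "d > 0" using assms unfolding D by (simp add: zero_less_mult_iff)
  then have "d = 2 * int (nat (d div 2)) + 1" using d by simp
  then have "\<not> 3 dvd m" using not_cube D by (metis dvdE)
  then show "finite {c. \<exists>x y. nontrivial_solution D c x y}"
    unfolding D using d by (intro finite_exponents)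
next
  fix j c :: nat and x :: int
  assume "D = 2 * (2 * int j + 1)"
  then show "(\<exists>y. nontrivial_solution D c x y) \<longleftrightarrow> (c = 0 \<and> odd x) \<or> (c = 1 \<and> even x)"
    using solution_iff_parity[of "2 * int j + 1" 1 c x] by simp
next
  fix j c :: nat and x :: int
  assume "D = 2 ^ 2 * (2 * int j + 1)"
  then show "(\<exists>y. nontrivial_solution D c x y) \<longleftrightarrow> (c = 0 \<and> odd x) \<or> (c = 2 \<and> even x)"
    using solution_iff_parity[of "2 * int j + 1" 2 c x] by simp
next
  fix k i c :: nat and x :: int
  assume "k > 0 \<and> i \<in> {1, 2} \<and> D = 2 ^ (3 * k + i)"
  then show "(\<exists>y. nontrivial_solution D c x y) \<longleftrightarrow>
      (\<exists>l :: nat. l < k + 1 \<and> [x = 2 ^ l] (mod 2 ^ (l + 1)) \<and> c = 3 * l) \<or>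
      ([x = 0] (mod 2 ^ (k + 1)) \<and> c = 3 * k + i)"
    using solution_iff_not_cube_exponent[of 1 i k c x] by simp
next
  assume "\<exists>k j :: nat. D = 2 ^ (3 * k) * (2 * int j + 1)"
  then obtain k j :: nat where D: "D = 2 ^ (3 * k) * (2 * int j + 1)" by blast
  have "c \<le> 3 * k" if "\<not> (\<exists>x y. nontrivial_solution D c x y)" for c
    using that solution_exists_above_cube_exponent[of "2 * int j + 1" k c] unfolding D
    by (auto simp: not_less[symmetric] simp del: not_less)
  then have "{c. \<not> (\<exists>x y. nontrivial_solution D c x y)} \<subseteq> {..3 * k}" by blast
  then show "finite {c. \<not> (\<exists>x y. nontrivial_solution D c x y)}"
    by (rule finite_subset) simp
qed

end
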